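(* Consider the uniform coloring game and let $L(1,n)$ be the maximum, over all uniform coloring games with at most $n$ players, of the length of a sequence of $1$-deviations. Let $m$ and $r$ be the unique non-negative integers such that $n = \frac{m(m+1)}{2} + r$ and $0 \le r \le m$. Then $L(1,n) = 2\binom{m+1}{3} + mr$. In particular $L(1,n) \sim \frac{2}{3} n\sqrt{n}$ as $n \to \infty$.
   Context: A coloring game is given by a finite set $V$ of $n$ players and a symmetric weight function $w$ assigning to each pair of distinct players $u,v$ a weight $w_{uv}=w_{vu}\in \mathbb{Z}\cup\{-\infty\}$. A state is a partition $P$ of $V$ into groups; $X(u)$ denotes the group of $u$. The utility of $u$ is $f_u(P)=\sum_{v\in X(u)\setminus\{u\}} w_{uv}$. For an integer $k\ge 1$, a $k$-deviation from $P$ is a set $S$ of at most $k$ players together with a group $X$ of $P$ (possibly empty, i.e. a new group) such that, after removing the players of $S$ from their groups and putting them all into $X$, every $u\in S$ has strictly larger utility. The game starts from the partition into $n$ singletons and repeatedly applies an arbitrary $k$-deviation as long as one exists. The game is uniform if every weight lies in $\{-\infty,1\}$. $L(k,n)$ denotes the maximum length of a sequence of successive $k$-deviations (starting from the all-singletons partition) over all uniform coloring games with at most $n$ players.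
   Formalization: The asymptotic claim is corrected to L(1,n) ~ (2/3) n sqrt(2n): by the exact formula, for n = m(m+1)/2 the ratio of L(1,n) to (2/3) n sqrt(n) tends to sqrt(2), not 1. *)

theory Defs
  imports
    Complex_Main
    "HOL-Library.Extended_Real"
    "HOL-Library.Disjoint_Sets"
    "HOL-Library.Landau_Symbols"
begin

text \<open>
  The weights in \<open>\<int> \<union> {-\<infinity>}\<close> are embedded in the extended reals; since \<open>\<infinity>\<close> is excluded, sums of
  weights behave as expected (\<open>-\<infinity>\<close> is absorbing). The diagonal of \<open>w\<close> is irrelevant.
\<close>

definition coloring_game :: "'a set \<Rightarrow> ('a \<Rightarrow> 'a \<Rightarrow> ereal) \<Rightarrow> bool" where
  "coloring_game V w \<longleftrightarrow> finite V \<and>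
     (\<forall>u\<in>V. \<forall>v\<in>V. u \<noteq> v \<longrightarrow>
        w u v = w v u \<and> w u v \<in> insert (-\<infinity>) (range (\<lambda>i::int. ereal (real_of_int i))))"

definition uniform_coloring_game :: "'a set \<Rightarrow> ('a \<Rightarrow> 'a \<Rightarrow> ereal) \<Rightarrow> bool" where
  "uniform_coloring_game V w \<longleftrightarrow>
     coloring_game V w \<and> (\<forall>u\<in>V. \<forall>v\<in>V. u \<noteq> v \<longrightarrow> w u v \<in> {-\<infinity>, 1})"

definition group_of :: "'a set set \<Rightarrow> 'a \<Rightarrow> 'a set" where
  "group_of P u = (THE X. X \<in> P \<and> u \<in> X)"

definition utility :: "('a \<Rightarrow> 'a \<Rightarrow> ereal) \<Rightarrow> 'a set set \<Rightarrow> 'a \<Rightarrow> ereal" where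
  "utility w P u = (\<Sum>v\<in>group_of P u - {u}. w u v)"

text \<open>Groups that become empty disappear, so that the result is again a partition.\<close>

definition move_to :: "'a set set \<Rightarrow> 'a set \<Rightarrow> 'a set \<Rightarrow> 'a set set" where
  "move_to P S X = insert (X \<union> S) ((\<lambda>Y. Y - S) ` (P - {X})) - {{}}"

text \<open>
  The deviating set is required to be nonempty: the empty set would satisfy the improvement
  condition vacuously, without changing the partition.
\<close>

definition is_deviation ::
    "'a set \<Rightarrow> ('a \<Rightarrow> 'a \<Rightarrow> ereal) \<Rightarrow> nat \<Rightarrow> 'a set set \<Rightarrow> 'a set \<Rightarrow> 'a set \<Rightarrow> bool" where
  "is_deviation V w k P S X \<longleftrightarrow>
     S \<subseteq> V \<and> S \<noteq> {} \<and> card S \<le> k \<and> X \<in> insert {} P \<and>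
     (\<forall>u\<in>S. utility w P u < utility w (move_to P S X) u)"

definition deviation_step ::
    "'a set \<Rightarrow> ('a \<Rightarrow> 'a \<Rightarrow> ereal) \<Rightarrow> nat \<Rightarrow> 'a set set \<Rightarrow> 'a set set \<Rightarrow> bool" where
  "deviation_step V w k P P' \<longleftrightarrow>
     partition_on V P \<and> (\<exists>S X. is_deviation V w k P S X \<and> P' = move_to P S X)"

definition singletons :: "'a set \<Rightarrow> 'a set set" where
  "singletons V = (\<lambda>u. {u}) ` V"

text \<open>
  The lengths of all sequences of successive \<open>k\<close>-deviations starting from the partition into
  singletons. Players are natural numbers, without loss of generality as every finite game is
  isomorphic to such a game.
\<close>

definition deviation_lengths :: "nat \<Rightarrow> nat \<Rightarrow> nat set" where
  "deviation_lengths k n =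
     {l. \<exists>(V :: nat set) w P. uniform_coloring_game V w \<and> card V \<le> n \<and>
           (deviation_step V w k ^^ l) (singletons V) P}"

text \<open>Only meaningful when \<^term>\<open>deviation_lengths k n\<close> is finite.\<close>

definition L :: "nat \<Rightarrow> nat \<Rightarrow> nat" where
  "L k n = Max (deviation_lengths k n)"

end

theory Submission
  imports Defs "HOL-Library.Multiset" "HOL-Real_Asymp.Real_Asymp"
begin

text \<open>
  In a sequence of deviations that starts from singletons, all groups consist of pairwise
  compatible players, so a deviation moves one player from a group of size \<open>a\<close> to another one of
  size \<open>b \<ge> a\<close>, and the question is about multisets of group sizes.

  Upper bound: let \<open>F c = (\<Sum>x. min x c)\<close> over the group sizes \<open>x\<close>. This is a concave sequence, and a
  deviation lowers it by 1 exactly on \<open>{a..b}\<close>. The minimum over all integer sequences \<open>f \<le> F\<close> of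
  \<open>\<Sum>(F - f) + \<Sum>\<Delta>f (\<Delta>f - 1) / 2\<close> (half of the \<open>defect\<close> below) is nonnegative and drops by at least 1 in
  every deviation: if \<open>f\<close> is admissible before a deviation to \<open>F'\<close>, then \<open>min f F'\<close> is a witness
  after it. At the start, the partial sums of the staircase \<open>m, m-1, \<dots>, 1\<close> with one more box in each
  of its first \<open>r\<close> rows give the value \<open>2 (m+1 choose 3) + m r\<close>.

  Lower bound: moves between groups of equal size lead from singletons to that staircase, and from
  there players are handed over, one at a time, from each group to the next larger one until a
  single group is left.
\<close>

section \<open>Triangular numbers and staircases\<close>

definition triangular :: "nat \<Rightarrow> nat" where
  "triangular m = m * (m + 1) div 2"

lemma triangular_Suc: "triangular (Suc m) = triangular m + Suc m"
  by (simp add: triangular_def)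

lemma triangular_mono: "m \<le> m' \<Longrightarrow> triangular m \<le> triangular m'"
  unfolding triangular_def by (intro div_le_mono mult_le_mono) simp_all

text \<open>
  Rows are numbered from 0. By truncated subtraction, the rows \<open>j \<ge> m\<close> are empty, except that
  row \<open>m\<close> has one box when \<open>r = m + 1\<close>.
\<close>

definition stair_row :: "nat \<Rightarrow> nat \<Rightarrow> nat \<Rightarrow> nat" where
  "stair_row m r j = m - j + of_bool (j < r)"

text \<open>Adds up the row numbers of all boxes; \<open>col_weight\<close> does the same for column
  numbers, since \<open>k choose 2 = 0 + ... + (k - 1)\<close>. Together they count each box with
  the number of its antidiagonal.\<close>

definition row_weight :: "nat \<Rightarrow> nat \<Rightarrow> nat" where
  "row_weight m r = (\<Sum>j\<le>m. j * stair_row m r j)"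

definition col_weight :: "nat \<Rightarrow> nat \<Rightarrow> nat" where
  "col_weight m r = (\<Sum>j\<le>m. stair_row m r j choose 2)"

lemma stair_row_next: "stair_row m (Suc m) = stair_row (Suc m) 0"
  by (auto simp: stair_row_def fun_eq_iff)

lemma stair_row_add_box:
  "r \<le> m \<Longrightarrow> stair_row m (Suc r) = (stair_row m r)(r := Suc (m - r))"
  "r \<le> m \<Longrightarrow> stair_row m r r = m - r"
  by (auto simp: stair_row_def fun_eq_iff)

lemma sum_upd_atMost:
  fixes m r :: nat
  assumes "r \<le> m"
  shows "(\<Sum>j\<le>m. h j ((p(r := x)) j)) + h r (p r) = (\<Sum>j\<le>m. h j (p j)) + (h r x :: nat)"
proof -
  have "(\<Sum>j\<le>m. h j ((p(r := x)) j)) = h r x + (\<Sum>j\<in>{..m} - {r}. h j (p j))"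
    using assms by (subst sum.remove[of _ r]) (auto intro!: sum.cong)
  moreover have "(\<Sum>j\<le>m. h j (p j)) = h r (p r) + (\<Sum>j\<in>{..m} - {r}. h j (p j))"
    using assms by (subst sum.remove[of _ r]) auto
  ultimately show ?thesis by linarith
qed

text \<open>Antidiagonal \<open>m\<close> is filled from the top: the box added to row
  \<open>r\<close> lies in column \<open>m - r\<close>, and these two numbers are the
  increments.\<close>

lemma sum_stair_row: "r \<le> Suc m \<Longrightarrow> (\<Sum>j\<le>m. stair_row m r j) = triangular m + r"
  and row_weight_Suc: "r \<le> m \<Longrightarrow> row_weight m (Suc r) = row_weight m r + r"
  and col_weight_Suc: "r \<le> m \<Longrightarrow> col_weight m (Suc r) = col_weight m r + (m - r)"
proof -
  have Suc: "(\<Sum>j\<le>m. stair_row m (Suc r) j) = Suc (\<Sum>j\<le>m. stair_row m r j)" if "r \<le> m" for m r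
    using sum_upd_atMost[OF that, of "\<lambda>j x. x" "stair_row m r" "Suc (m - r)"] that
    by (simp add: stair_row_add_box)
  have "(\<Sum>j\<le>m. stair_row m 0 j) = triangular m" for m
  proof -
    have "(\<Sum>j\<le>m. stair_row m 0 j) = (\<Sum>j\<le>m. j)"
      by (rule sum.reindex_bij_witness[of _ "\<lambda>j. m - j" "\<lambda>j. m - j"]) (auto simp: stair_row_def)
    then show ?thesis by (simp add: gauss_sum_nat atMost_atLeast0 triangular_def)
  qed
  then show "r \<le> Suc m \<Longrightarrow> (\<Sum>j\<le>m. stair_row m r j) = triangular m + r"
    by (induction r) (simp_all add: Suc)
  show "row_weight m (Suc r) = row_weight m r + r" if "r \<le> m"
    using sum_upd_atMost[OF that, of "\<lambda>j x. j * x" "stair_row m r" "Suc (m - r)"] that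
    by (simp add: stair_row_add_box row_weight_def)
  show "col_weight m (Suc r) = col_weight m r + (m - r)" if "r \<le> m"
    using sum_upd_atMost[OF that, of "\<lambda>j x. x choose 2" "stair_row m r" "Suc (m - r)"] that
    by (simp add: stair_row_add_box col_weight_def numeral_2_eq_2)
qed

lemma weight_next:
  "row_weight (Suc m) 0 = row_weight m (Suc m)"
  "col_weight (Suc m) 0 = col_weight m (Suc m)"
  by (simp_all add: row_weight_def col_weight_def stair_row_next) (simp_all add: stair_row_def)

lemma twice_choose_two: "2 * (k choose 2) = k * (k - 1)"
  by (cases k) (simp_all add: choose_two binomial_eq_0)

text \<open>Each of the \<open>r\<close> extra boxes has row plus column equal to \<open>m\<close>.
  Below them, antidiagonal \<open>d < m\<close> has \<open>d + 1\<close> boxes of value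
  \<open>d\<close>, and these products \<open>d * (d + 1)\<close> sum to
  \<open>2 * ((m + 1) choose 3)\<close>.\<close>

lemma weight_eq:
  assumes "r \<le> Suc m"
  shows "row_weight m r + col_weight m r = 2 * ((m + 1) choose 3) + m * r"
proof -
  have step: "row_weight m r + col_weight m r = row_weight m 0 + col_weight m 0 + m * r"
    if "r \<le> Suc m" for m r
    using that by (induction r) (simp_all add: row_weight_Suc col_weight_Suc)
  have "row_weight m 0 + col_weight m 0 = 2 * ((m + 1) choose 3)"
  proof (induction m)
    case 0
    then show ?case by (simp add: row_weight_def col_weight_def stair_row_def binomial_eq_0)
  next
    case (Suc m)
    have "2 * (Suc m choose 2) = m * Suc m"
      by (simp add: twice_choose_two)
    with Suc step[of "Suc m" m] show ?case
      by (simp add: weight_next numeral_3_eq_3 numeral_2_eq_2 algebra_simps)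
  qed
  with step[OF assms] show ?thesis by simp
qed

lemma triangular_decomposition:
  fixes n :: nat
  shows "\<exists>!(m, r). n = triangular m + r \<and> r \<le> m"
proof -
  have "\<exists>m r. n = triangular m + r \<and> r \<le> m"
  proof (induction n)
    case (Suc n)
    then obtain m r where mr: "n = triangular m + r" "r \<le> m" by blast
    show ?case
    proof (cases "r < m")
      case True
      with mr show ?thesis by (intro exI[of _ m] exI[of _ "Suc r"]) simp
    next
      case False
      with mr triangular_Suc[of m] show ?thesis by (intro exI[of _ "Suc m"] exI[of _ 0]) simp
    qed
  qed (auto intro!: exI[of _ 0] simp: triangular_def)
  then obtain m r where mr: "n = triangular m + r" "r \<le> m" by blast
  have unique: "m = m' \<and> r = r'" if mr': "n = triangular m' + r'" "r' \<le> m'" for m' r'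
  proof -
    \<comment> \<open>\<open>triangular (Suc m)\<close> already exceeds
      \<open>triangular m + r\<close>, so the ranges belonging to different \<open>m\<close> do not
      overlap.\<close>
    have "\<not> m < m'" "\<not> m' < m"
      using mr mr' triangular_mono[of "Suc m" m'] triangular_mono[of "Suc m'" m]
        triangular_Suc[of m] triangular_Suc[of m'] by linarith+
    with mr mr' show ?thesis by simp
  qed
  show ?thesis
    using mr by (intro ex1I[of _ "(m, r)"]) (auto dest: unique)
qed

text \<open>Covers games with fewer than \<open>n\<close> players. Different values of
  \<open>m\<close> are compared through the completed antidiagonal \<open>r = Suc m\<close>, for
  which \<open>weight_eq\<close> still holds.\<close>

lemma weight_mono:
  assumes n: "triangular m + r \<le> triangular m' + r'" and "r \<le> m" "r' \<le> m'"
  shows "2 * ((m + 1) choose 3) + m * r \<le> 2 * ((m' + 1) choose 3) + m' * r'"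
proof (cases m m' rule: linorder_cases)
  case less
  have "2 * ((m + 1) choose 3) + m * r \<le> row_weight m (Suc m) + col_weight m (Suc m)"
    using assms mult_le_mono2[of r "Suc m" m] by (simp add: weight_eq)
  also have "\<dots> = 2 * ((Suc m + 1) choose 3)"
    by (simp only: weight_next[symmetric] weight_eq)
  also have "\<dots> \<le> 2 * ((m' + 1) choose 3)"
    using less by (intro mult_le_mono binomial_right_mono) auto
  finally show ?thesis by simp
next
  case equal
  with n show ?thesis by simp
next
  case greater
  with assms triangular_mono[of "Suc m'" m] triangular_Suc[of m'] show ?thesis by linarith
qed

section \<open>The potential function\<close>

definition defect :: "nat \<Rightarrow> (nat \<Rightarrow> int) \<Rightarrow> (nat \<Rightarrow> int) \<Rightarrow> int" where
  "defect N F f =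
     2 * (\<Sum>c\<le>N. F c - f c) + (\<Sum>c<N. (f (Suc c) - f c) * (f (Suc c) - f c - 1))"

lemma consecutive_prod_nonneg: "0 \<le> d * (d - 1)" for d :: int
  by (cases "d \<le> 0") (auto intro: mult_nonpos_nonpos)

lemma defect_nonneg:
  assumes "\<And>c. f c \<le> F c"
  shows "0 \<le> defect N F f"
  unfolding defect_def using assms
  by (intro add_nonneg_nonneg mult_nonneg_nonneg sum_nonneg consecutive_prod_nonneg) auto

lemma sum_by_parts:
  fixes d e :: "nat \<Rightarrow> int"
  shows "(\<Sum>c<n. d c * (e (Suc c) - e c)) =
    d n * e n - d 0 * e 0 - (\<Sum>c<n. e (Suc c) * (d (Suc c) - d c))"
  by (induction n) (simp_all add: algebra_simps)

text \<open>Here \<open>F\<close> is the sequence after the deviation. Passing from \<open>f\<close>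
  to \<open>g\<close> changes the differences by \<delta>; expanding the quadratic gives a cross
  term, nonnegative by concavity, and two further nonnegative terms, one of which supplies the
  2.\<close>

lemma defect_decrease:
  fixes F f :: "nat \<Rightarrow> int"
  defines "g \<equiv> \<lambda>c. min (f c) (F c)"
  assumes concave: "\<And>k. F k + F (Suc (Suc k)) \<le> 2 * F (Suc k)"
    and ab: "1 \<le> a" "a \<le> b" "b < N"
    and le: "\<And>c. f c \<le> F c + of_bool (c \<in> {a..b})"
  shows "defect N F g + 2 \<le> defect N (\<lambda>c. F c + of_bool (c \<in> {a..b})) f"
proof -
  define e where "e = (\<lambda>c. f c - g c)"
  define d where "d = (\<lambda>c. g (Suc c) - g c)"
  define \<delta> where "\<delta> = (\<lambda>c. e (Suc c) - e c)"
  \<comment> \<open>Since \<open>f\<close> exceeds \<open>F\<close> by at most 1, \<open>e\<close>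
    is the indicator of the set where it does, a subset of \<open>{a..b}\<close>.\<close>
  have e01: "e c = 0 \<or> e c = 1 \<and> c \<in> {a..b} \<and> f c = F c + 1" for c
    using le[of c] by (cases "c \<in> {a..b}") (auto simp: e_def g_def min_def)
  have e_le: "e c \<le> of_bool (c \<in> {a..b})" for c
    using e01[of c] by auto
  have e0: "e 0 = 0" and eN: "e N = 0"
    using e01[of 0] e01[of N] ab by auto
  have square: "(f (Suc c) - f c) * (f (Suc c) - f c - 1) =
      d c * (d c - 1) + 2 * (d c * \<delta> c) + \<delta> c * (\<delta> c - 1)" for c
    by (simp add: d_def \<delta>_def e_def algebra_simps)
  then have "defect N (\<lambda>c. F c + of_bool (c \<in> {a..b})) f =
      2 * (\<Sum>c\<le>N. (F c - g c) + (of_bool (c \<in> {a..b}) - e c)) +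
      (\<Sum>c<N. d c * (d c - 1) + 2 * (d c * \<delta> c) + \<delta> c * (\<delta> c - 1))"
    unfolding defect_def square by (simp add: e_def algebra_simps)
  then have split: "defect N (\<lambda>c. F c + of_bool (c \<in> {a..b})) f =
      defect N F g + 2 * (\<Sum>c\<le>N. of_bool (c \<in> {a..b}) - e c) +
      2 * (\<Sum>c<N. d c * \<delta> c) + (\<Sum>c<N. \<delta> c * (\<delta> c - 1))"
    by (simp only: sum.distrib defect_def d_def sum_distrib_left[symmetric])
       (simp add: algebra_simps)
  \<comment> \<open>Where \<open>e (Suc c) = 1\<close>, \<open>g\<close> touches \<open>F\<close>
    and stays below it at both neighbours, so its second difference there is at most that of
    \<open>F\<close>.\<close>
  have "e (Suc c) * (d (Suc c) - d c) \<le> 0" for c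
  proof (cases "e (Suc c) = 0")
    case False
    with e01[of "Suc c"] have "e (Suc c) = 1" "f (Suc c) = F (Suc c) + 1" by auto
    with concave[of c] show ?thesis
      by (simp add: d_def g_def min_def)
  qed simp
  then have parts: "0 \<le> (\<Sum>c<N. d c * \<delta> c)"
    unfolding \<delta>_def sum_by_parts by (simp add: e0 eN sum_nonpos)
  have slack: "0 \<le> (\<Sum>c\<le>N. of_bool (c \<in> {a..b}) - e c)"
    using e_le by (intro sum_nonneg) simp
  show ?thesis
  \<comment> \<open>If \<open>e\<close> takes the value 1, it must fall back to
    \<open>e N = 0\<close>, and a fall \<delta> = -1 contributes 2 to the last sum. Otherwise the
    slack at \<open>a\<close> is 1 and counts twice.\<close>
  proof (cases "\<exists>k\<le>N. e k = 1")
    case True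
    then obtain k where k: "k \<le> N" "e k = 1" by blast
    have "(\<Sum>c=k..<N. \<delta> c) = - 1"
      unfolding \<delta>_def using k eN by (simp add: sum_Suc_diff')
    then obtain c where c: "k \<le> c" "c < N" "\<delta> c < 0"
      using sum_nonneg[of "{k..<N}" \<delta>] by fastforce
    have "\<delta> c = - 1"
      using c(3) e01[of c] e01[of "Suc c"] by (auto simp: \<delta>_def)
    then have "2 \<le> (\<Sum>c<N. \<delta> c * (\<delta> c - 1))"
      using member_le_sum[of c "{..<N}" "\<lambda>c. \<delta> c * (\<delta> c - 1)"] c consecutive_prod_nonneg
      by simp
    with split parts slack show ?thesis by linarith
  next
    case False
    then have "\<And>c. c \<le> N \<Longrightarrow> e c = 0" using e01 by blast
    then have "1 \<le> (\<Sum>c\<le>N. of_bool (c \<in> {a..b}) - e c)"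
      using member_le_sum[of a "{..N}" "\<lambda>c. of_bool (c \<in> {a..b}) - e c"] e_le ab
      by simp
    moreover have "0 \<le> (\<Sum>c<N. \<delta> c * (\<delta> c - 1))"
      by (intro sum_nonneg consecutive_prod_nonneg)
    ultimately show ?thesis using split parts by linarith
  qed
qed

section \<open>Merging steps on multisets of group sizes\<close>

text \<open>With unit weights the mover's utility goes from \<open>a - 1\<close> to
  \<open>b\<close>, hence the condition \<open>a \<le> b\<close>. An emptied group is dropped rather
  than kept as a size 0.\<close>

definition merge_step :: "nat multiset \<Rightarrow> nat multiset \<Rightarrow> bool" where
  "merge_step M N \<longleftrightarrow> (\<exists>a b R. 1 \<le> a \<and> a \<le> b \<and> M = {#a, b#} + R \<and>
     N = add_mset (Suc b) ((if a = 1 then {#} else {#a - 1#}) + R))"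

text \<open>These are the partial sums of the conjugate partition: the increment at \<open>c\<close>
  is the number of sizes greater than \<open>c\<close>, which explains concavity.\<close>

definition capped_sum :: "nat multiset \<Rightarrow> nat \<Rightarrow> int" where
  "capped_sum M c = (\<Sum>x\<in>#M. int (min x c))"

lemma capped_sum_concave:
  "capped_sum M k + capped_sum M (Suc (Suc k)) \<le> 2 * capped_sum M (Suc k)"
  unfolding capped_sum_def by (induction M) (auto simp: min_def)

text \<open>Shrinking \<open>a\<close> loses 1 exactly for \<open>c \<ge> a\<close>, growing
  \<open>b\<close> gains 1 exactly for \<open>c > b\<close>. A dropped block would have contributed
  0.\<close>

lemma capped_sum_step:
  assumes "1 \<le> a" "a \<le> b"
  shows "capped_sum ({#a, b#} + R) c =
    capped_sum (add_mset (Suc b) ((if a = 1 then {#} else {#a - 1#}) + R)) c +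
    of_bool (c \<in> {a..b})"
  using assms by (auto simp: capped_sum_def min_def)

lemma merge_step_sum: "merge_step M N \<Longrightarrow> sum_mset N = sum_mset M"
  by (auto simp: merge_step_def)

lemma sum_stair_row_lessThan:
  fixes h :: "nat \<Rightarrow> nat \<Rightarrow> nat"
  assumes "r \<le> m" "m \<le> N" "\<And>j. h j 0 = 0"
  shows "(\<Sum>j<N. h j (stair_row m r j)) = (\<Sum>j\<le>m. h j (stair_row m r j))"
proof (cases "m < N")
  case True
  have "stair_row m r j = 0" if "\<not> j \<le> m" for j
    using assms(1) that by (simp add: stair_row_def)
  with True assms show ?thesis
    by (intro sum.mono_neutral_right) auto
next
  case False
  with assms have "N = m" "stair_row m r m = 0" by (simp_all add: stair_row_def)
  with assms show ?thesis by (simp add: lessThan_Suc_atMost[symmetric])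
qed

text \<open>For \<open>c > 0\<close> the summand is the tail of \<mu> from \<open>c\<close> on, so
  \<open>\<mu> j\<close> is counted once for each \<open>c\<close> in \<open>{1..j}\<close>.\<close>

lemma sum_tail_sums:
  fixes \<mu> :: "nat \<Rightarrow> nat"
  shows "(\<Sum>c\<le>N. (\<Sum>j<N. int (\<mu> j)) * of_bool (0 < c) - (\<Sum>j<c. int (\<mu> j))) =
    (\<Sum>j<N. int (j * \<mu> j))"
proof (induction N)
  case (Suc N)
  have "(\<Sum>c\<le>N. of_bool (0 < c)) = int N"
    by (induction N) auto
  with Suc show ?case
    by (simp add: sum.distrib sum_subtractf distrib_right distrib_left sum_distrib_left[symmetric])
qed simp

lemma merge_steps_le:
  assumes n: "n = triangular m + r" "r \<le> m"
    and "(merge_step ^^ l) (replicate_mset n 1) M"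
  shows "l \<le> 2 * ((m + 1) choose 3) + m * r"
proof -
  define B where "B = int (row_weight m r + col_weight m r)"
  have "sum_mset M = n \<and>
      (\<exists>f. (\<forall>c. f c \<le> capped_sum M c) \<and> defect n (capped_sum M) f + 2 * int l \<le> 2 * B)"
    using assms(3)
  proof (induction l arbitrary: M)
    case 0
    \<comment> \<open>The initial capped sum is \<open>n\<close> from \<open>c = 1\<close> on, so
      the gap to these partial sums is a tail sum and yields \<open>row_weight\<close>; the
      differences of \<open>f\<close> are the row lengths and yield
      \<open>col_weight\<close>.\<close>
    define f where "f = (\<lambda>c. \<Sum>j<c. int (stair_row m r j))"
    have "m \<le> n" using n(1) by (cases m) (auto simp: triangular_Suc)
    have total: "(\<Sum>j<k. stair_row m r j) = n" if "m \<le> k" for k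
      using sum_stair_row_lessThan[of r m k "\<lambda>_ x. x"] that n sum_stair_row[of r m] by simp
    have F: "capped_sum M c = int n * of_bool (0 < c)" for c
      using 0 by (auto simp: capped_sum_def)
    have "f c \<le> capped_sum M c" for c
    proof (cases "c = 0")
      case False
      have "(\<Sum>j<c. stair_row m r j) \<le> (\<Sum>j<max c m. stair_row m r j)"
        by (intro sum_mono2) auto
      with False show ?thesis by (simp add: F f_def total flip: of_nat_sum)
    qed (simp add: F f_def)
    moreover have "defect n (capped_sum M) f = 2 * B"
    proof -
      have "(\<Sum>c\<le>n. capped_sum M c - f c) = int (row_weight m r)"
        using sum_tail_sums[of "stair_row m r" n] sum_stair_row_lessThan[of r m n "\<lambda>j x. j * x"]
          n \<open>m \<le> n\<close> total[OF \<open>m \<le> n\<close>]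
        by (simp add: F f_def row_weight_def flip: of_nat_sum of_nat_mult)
      moreover have "int k * (int k - 1) = 2 * int (k choose 2)" for k :: nat
      proof -
        have "2 * int (k choose 2) = int (k * (k - 1))"
          by (simp only: twice_choose_two[symmetric])
        then show ?thesis by (cases k) (auto simp: algebra_simps)
      qed
      then have "(\<Sum>c<n. (f (Suc c) - f c) * (f (Suc c) - f c - 1)) = 2 * int (col_weight m r)"
        using sum_stair_row_lessThan[of r m n "\<lambda>_ x. x choose 2"] n \<open>m \<le> n\<close>
        by (simp add: f_def col_weight_def binomial_eq_0 sum_distrib_left[symmetric] flip: of_nat_sum)
      ultimately show ?thesis by (simp add: defect_def B_def)
    qed
    ultimately show ?case using 0 by (intro conjI exI[of _ f]) auto
  next
    case (Suc l)
    then obtain K where "(merge_step ^^ l) (replicate_mset n 1) K" and KM: "merge_step K M"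
      by auto
    with Suc.IH obtain f where K: "sum_mset K = n" "\<And>c. f c \<le> capped_sum K c"
      and f: "defect n (capped_sum K) f + 2 * int l \<le> 2 * B" by blast
    obtain a b R where ab: "1 \<le> a" "a \<le> b" "K = {#a, b#} + R"
      "M = add_mset (Suc b) ((if a = 1 then {#} else {#a - 1#}) + R)"
      using KM unfolding merge_step_def by blast
    have cap: "capped_sum K = (\<lambda>c. capped_sum M c + of_bool (c \<in> {a..b}))"
      unfolding ab(3,4) using capped_sum_step[OF ab(1,2)] by blast
    \<comment> \<open>The donor block has at least one box besides the \<open>b\<close> of the
      receiver. This keeps \<open>{a..b}\<close> strictly below the end \<open>n\<close> of the
      defect sum.\<close>
    have "b < n" using K(1) ab by auto
    from defect_decrease[of "capped_sum M" a b n f, OF capped_sum_concave ab(1,2) this] K(2) f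
    have "defect n (capped_sum M) (\<lambda>c. min (f c) (capped_sum M c)) + 2 * int (Suc l) \<le> 2 * B"
      unfolding cap by simp
    with K(1) merge_step_sum[OF KM] show ?case
      by (intro conjI exI[of _ "\<lambda>c. min (f c) (capped_sum M c)"]) auto
  qed
  then obtain f where "\<And>c. f c \<le> capped_sum M c" "defect n (capped_sum M) f + 2 * int l \<le> 2 * B"
    by blast
  then have "int l \<le> B" using defect_nonneg[of f "capped_sum M" n] by simp
  then show ?thesis using n(2) weight_eq[of r m] by (simp add: B_def del: of_nat_add)
qed

section \<open>Lower bound: building and collapsing the staircase\<close>

lemma merge_stepI:
  assumes "1 \<le> a" "a \<le> b" "M = {#a, b#} + R"
    "N = add_mset (Suc b) ((if a = 1 then {#} else {#a - 1#}) + R)"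
  shows "merge_step M N"
  unfolding merge_step_def using assms by blast

text \<open>The new block takes one box from the blocks of sizes \<open>1, \<dots>, k\<close> in turn, each time at equal sizes.\<close>

lemma climb:
  "(merge_step ^^ k) (add_mset 1 (mset_set {1..k}) + R)
     (add_mset (Suc k) (mset_set {1..<k}) + R)"
proof -
  \<comment> \<open>After \<open>j\<close> moves the blocks \<open>1, ..., j\<close> have become
    \<open>0, ..., j - 1\<close>, with 0 dropped, and the larger ones are untouched.\<close>
  have "(merge_step ^^ j) (add_mset 1 (mset_set {1..k}) + R)
      (add_mset (Suc j) (mset_set {1..<j} + mset_set {Suc j..k}) + R)" if "j \<le> k" for j
    using that
  proof (induction j)
    case (Suc j)
    have "{Suc j..k} = insert (Suc j) {Suc (Suc j)..k}"
      using Suc.prems by auto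
    then have top: "mset_set {Suc j..k} = add_mset (Suc j) (mset_set {Suc (Suc j)..k})"
      by simp
    have bot: "mset_set {1..<Suc j} = (if Suc j = 1 then {#} else {#j#}) + mset_set {1..<j}"
    proof (cases "j = 0")
      case False
      then have "{1..<Suc j} = insert j {1..<j}" by auto
      then show ?thesis using False by (simp del: One_nat_def)
    qed simp
    have "merge_step (add_mset (Suc j) (mset_set {1..<j} + mset_set {Suc j..k}) + R)
        (add_mset (Suc (Suc j)) (mset_set {1..<Suc j} + mset_set {Suc (Suc j)..k}) + R)"
      by (rule merge_stepI[of "Suc j" "Suc j" _
            "mset_set {1..<j} + mset_set {Suc (Suc j)..k} + R"]) (simp_all add: top bot del: One_nat_def)
    with Suc show ?case by (auto intro: relpowp_Suc_I)
  qed simp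
  from this[of k] show ?thesis by simp
qed

text \<open>For \<open>r \<le> m\<close> these are the nonzero row lengths of
  \<open>stair_row m r\<close>: all sizes up to \<open>m + 1\<close> except
  \<open>m - r + 1\<close>.\<close>

definition staircase :: "nat \<Rightarrow> nat \<Rightarrow> nat multiset" where
  "staircase m r = mset_set ({1..m - r} \<union> {m - r + 2..m + 1})"

text \<open>A fresh singleton climbs to the missing size \<open>m - r + 1\<close>, and the gap moves
  down to \<open>m - r\<close>. The number of moves is the column of the added box; for
  \<open>r = m\<close> the singleton itself fills the gap.\<close>

lemma staircase_add_box:
  assumes "r \<le> m"
  shows "(merge_step ^^ (m - r)) (add_mset 1 (staircase m r) + R)
    ((if r = m then staircase (Suc m) 0 else staircase m (Suc r)) + R)"
proof -
  let ?k = "m - r"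
  have "staircase m r = mset_set {1..?k} + mset_set {?k + 2..m + 1}"
    unfolding staircase_def by (subst mset_set_Union) auto
  moreover have "(if r = m then staircase (Suc m) 0 else staircase m (Suc r)) =
      add_mset (Suc ?k) (mset_set {1..<?k}) + mset_set {?k + 2..m + 1}"
  proof -
    have "add_mset (Suc ?k) (mset_set {1..<?k}) + mset_set {?k + 2..m + 1} =
        mset_set ({1..<?k} \<union> insert (Suc ?k) {?k + 2..m + 1})"
      by (subst mset_set_Union) auto
    also have "insert (Suc ?k) {?k + 2..m + 1} = {Suc ?k..m + 1}"
      by auto
    also have "mset_set ({1..<?k} \<union> {Suc ?k..m + 1}) =
        (if r = m then staircase (Suc m) 0 else staircase m (Suc r))"
      unfolding staircase_def using assms
      by (auto intro!: arg_cong[of _ _ mset_set])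
    finally show ?thesis by simp
  qed
  ultimately show ?thesis
    using climb[of ?k "mset_set {?k + 2..m + 1} + R"] by (simp add: add.assoc)
qed

text \<open>The \<open>t\<close> spare singletons make the induction work: each step uses the
  hypothesis with \<open>Suc t\<close> and consumes one of them.\<close>

lemma build_staircase:
  assumes "r \<le> m"
  shows "(merge_step ^^ col_weight m r) (replicate_mset (triangular m + r + t) 1)
    (staircase m r + replicate_mset t 1)"
  using assms
proof (induction m arbitrary: r t)
  case 0
  then show ?case
    by (simp add: col_weight_def stair_row_def binomial_eq_0 triangular_def staircase_def)
next
  case (Suc m)
  show ?case using Suc.prems
  proof (induction r arbitrary: t)
    case 0
    have "(merge_step ^^ col_weight m m) (replicate_mset (triangular m + m + Suc t) 1)
        (staircase m m + replicate_mset (Suc t) 1)"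
      by (rule Suc.IH) simp
    moreover have "staircase (Suc m) 0 = add_mset 1 (staircase m m)"
      using staircase_add_box[of m m "{#}"] by simp
    ultimately show ?case by (simp add: weight_next col_weight_Suc triangular_Suc add_ac)
  next
    case (Suc r)
    have "(merge_step ^^ col_weight (Suc m) r) (replicate_mset (triangular (Suc m) + r + Suc t) 1)
        (staircase (Suc m) r + replicate_mset (Suc t) 1)"
      using Suc.prems by (intro Suc.IH) simp
    moreover have "(merge_step ^^ (Suc m - r)) (staircase (Suc m) r + replicate_mset (Suc t) 1)
        (staircase (Suc m) (Suc r) + replicate_mset t 1)"
      using staircase_add_box[of r "Suc m" "replicate_mset t 1"] Suc.prems by simp
    ultimately have "(merge_step ^^ (col_weight (Suc m) r + (Suc m - r)))
        (replicate_mset (triangular (Suc m) + r + Suc t) 1)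
        (staircase (Suc m) (Suc r) + replicate_mset t 1)"
      by (rule relpowp_trans)
    moreover have "col_weight (Suc m) (Suc r) = col_weight (Suc m) r + (Suc m - r)"
      using Suc.prems by (intro col_weight_Suc) simp
    ultimately show ?case by (simp only: add_Suc add_Suc_right)
  qed
qed

text \<open>
  Each block passes one box on to its predecessor and is refilled by its successor, so that in total
  only the first and the last size change; strictness of the order keeps the single moves legal.
\<close>

lemma conveyor:
  assumes "sorted_wrt (>) (xs @ [Suc l])" "\<forall>y\<in>set (xs @ [Suc l]). y \<le> x"
  shows "(merge_step ^^ Suc (length xs)) (mset (x # xs @ [Suc l]) + R)
    (mset (Suc x # xs) + (if l = 0 then {#} else {#l#}) + R)"
  using assms
proof (induction xs arbitrary: x R)
  case Nil
  then have "merge_step (mset (x # [Suc l]) + R) (mset [Suc x] + (if l = 0 then {#} else {#l#}) + R)"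
    by (intro merge_stepI[of "Suc l" x _ R]) auto
  then show ?case by auto
next
  case (Cons z xs)
  have z: "Suc l < z" using Cons.prems by auto
  have "merge_step (mset (x # (z # xs) @ [Suc l]) + R)
      (mset ((z - 1) # xs @ [Suc l]) + add_mset (Suc x) R)"
    using Cons.prems z by (intro merge_stepI[of z x _ "mset (xs @ [Suc l]) + R"]) auto
  moreover have "(merge_step ^^ Suc (length xs)) (mset ((z - 1) # xs @ [Suc l]) + add_mset (Suc x) R)
      (mset (Suc (z - 1) # xs) + (if l = 0 then {#} else {#l#}) + add_mset (Suc x) R)"
    using Cons.prems z by (intro Cons.IH) fastforce+
  ultimately have "(merge_step ^^ Suc (Suc (length xs))) (mset (x # (z # xs) @ [Suc l]) + R)
      (mset (Suc (z - 1) # xs) + (if l = 0 then {#} else {#l#}) + add_mset (Suc x) R)"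
    by (rule relpowp_Suc_I2)
  with z show ?case by (simp add: add_mset_commute)
qed

text \<open>Each run of \<open>conveyor\<close> moves a net box from the last block to the first and
  preserves the strict order, so \<open>l\<close> runs empty the last block.\<close>

lemma drain:
  assumes "sorted_wrt (>) (x # xs @ [l])"
  shows "(merge_step ^^ (l * Suc (length xs))) (mset (x # xs) + (if l = 0 then {#} else {#l#}))
    (mset ((x + l) # xs))"
  using assms
proof (induction l arbitrary: x)
  case (Suc l)
  have "(merge_step ^^ Suc (length xs)) (mset (x # xs @ [Suc l]) + {#})
    (mset (Suc x # xs) + (if l = 0 then {#} else {#l#}) + {#})"
    using Suc.prems by (intro conveyor) (auto simp: less_imp_le)
  moreover have "(merge_step ^^ (l * Suc (length xs)))
      (mset (Suc x # xs) + (if l = 0 then {#} else {#l#})) (mset ((Suc x + l) # xs))"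
    using Suc.prems by (intro Suc.IH) (fastforce simp: sorted_wrt_append)
  ultimately have "(merge_step ^^ (Suc (length xs) + l * Suc (length xs)))
      (mset (x # xs @ [Suc l])) (mset ((Suc x + l) # xs))"
    by (intro relpowp_trans) simp_all
  moreover have "mset (x # xs @ [Suc l]) = mset (x # xs) + (if Suc l = 0 then {#} else {#Suc l#})"
    by simp
  ultimately show ?case by (simp only: mult_Suc add_Suc add_Suc_right)
qed simp

text \<open>Draining starts with the last, smallest block. Each box of the block at position
  \<open>Suc i\<close> costs \<open>Suc i\<close> moves, which is its row number in the
  staircase.\<close>

lemma collapse:
  assumes "sorted_wrt (>) (x # xs)" "0 \<notin> set xs"
  shows "(merge_step ^^ (\<Sum>i<length xs. Suc i * xs ! i)) (mset (x # xs)) {#x + sum_list xs#}"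
  using assms
proof (induction xs arbitrary: x rule: rev_induct)
  case (snoc l xs)
  have "(merge_step ^^ (l * Suc (length xs))) (mset (x # xs @ [l])) (mset ((x + l) # xs))"
    using drain[of x xs l] snoc.prems by auto
  moreover have "(merge_step ^^ (\<Sum>i<length xs. Suc i * xs ! i)) (mset ((x + l) # xs))
      {#(x + l) + sum_list xs#}"
    using snoc.prems by (intro snoc.IH) (auto simp: sorted_wrt_append)
  ultimately have "(merge_step ^^ (l * Suc (length xs) + (\<Sum>i<length xs. Suc i * xs ! i)))
      (mset (x # xs @ [l])) {#(x + l) + sum_list xs#}"
    by (rule relpowp_trans)
  then show ?case by (simp add: nth_append add_ac mult.commute)
qed simp

lemma collapse_staircase:
  assumes "r \<le> m" "0 < m"
  shows "\<exists>M. (merge_step ^^ row_weight m r) (staircase m r) M"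
proof -
  define xs where "xs = map (stair_row m r) [1..<m]"
  have list: "stair_row m r 0 # xs = map (stair_row m r) [0..<m]"
    using assms by (simp add: xs_def upt_conv_Cons)
  have anti: "stair_row m r j < stair_row m r i" if "i < j" "j < m" for i j
    using that by (auto simp: stair_row_def)
  then have sorted: "sorted_wrt (>) (stair_row m r 0 # xs)"
    unfolding list by (auto simp: sorted_wrt_iff_nth_less)
  have "stair_row m r ` {0..<m} = {1..m - r} \<union> {m - r + 2..m + 1}"
  proof (intro equalityI subsetI)
    fix x assume "x \<in> {1..m - r} \<union> {m - r + 2..m + 1}"
    \<comment> \<open>Sizes up to \<open>m - r\<close> come from rows without an extra box, the
      larger ones from rows with one.\<close>
    then have "x = stair_row m r (if x \<le> m - r then m - x else m + 1 - x) \<and>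
        (if x \<le> m - r then m - x else m + 1 - x) < m"
      using assms by (auto simp: stair_row_def)
    then show "x \<in> stair_row m r ` {0..<m}" by fastforce
  qed (use assms in \<open>auto simp: stair_row_def\<close>)
  moreover have "inj_on (stair_row m r) {0..<m}"
    by (rule linorder_inj_onI) (use anti in fastforce)+
  then have "distinct (stair_row m r 0 # xs)"
    by (simp add: list distinct_map)
  ultimately have "mset (stair_row m r 0 # xs) = staircase m r"
    unfolding staircase_def by (subst mset_set_set[symmetric]) (simp_all add: list)
  moreover have "(\<Sum>i<length xs. Suc i * xs ! i) = row_weight m r"
  proof -
    have "row_weight m r = (\<Sum>j<m. j * stair_row m r j)"
      unfolding row_weight_def using assms(1)
      by (intro sum_stair_row_lessThan[symmetric]) auto
    also have "\<dots> = (\<Sum>i<m - 1. Suc i * stair_row m r (Suc i))"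
      using assms(2) by (cases m) (simp_all add: sum.lessThan_Suc_shift del: sum.lessThan_Suc)
    finally show ?thesis by (simp add: xs_def)
  qed
  moreover have "0 \<notin> set xs"
    by (auto simp: xs_def stair_row_def)
  ultimately show ?thesis
    using collapse[OF sorted] by metis
qed

lemma merge_steps_exist:
  assumes "r \<le> m"
  shows "\<exists>M. (merge_step ^^ (2 * ((m + 1) choose 3) + m * r)) (replicate_mset (triangular m + r) 1) M"
proof (cases "m = 0")
  case False
  then obtain M where "(merge_step ^^ row_weight m r) (staircase m r) M"
    using collapse_staircase assms by blast
  with build_staircase[OF assms, of 0]
  have "(merge_step ^^ (col_weight m r + row_weight m r)) (replicate_mset (triangular m + r) 1) M"
    by (intro relpowp_trans) auto
  with weight_eq[of r m] assms show ?thesis by (auto simp: add.commute)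
next
  case True
  with assms show ?thesis by (auto simp: binomial_eq_0)
qed

section \<open>From deviations to merging steps\<close>

definition group_sizes :: "'a set set \<Rightarrow> nat multiset" where
  "group_sizes P = image_mset card (mset_set P)"

lemma group_of_eq:
  assumes "partition_on V P" "X \<in> P" "u \<in> X"
  shows "group_of P u = X"
  unfolding group_of_def using assms partition_onD2[OF assms(1)]
  by (intro the_equality) (auto simp: disjoint_def)

text \<open>Serves both directions of the simulation. The third claim lets unit weights inside
  groups persist, the fourth is the effect on sizes.\<close>

lemma move_player:
  assumes P: "partition_on V P" and V: "finite V"
    and X: "X \<in> P" and Y: "Y \<in> P" "X \<noteq> Y" and u: "u \<in> Y"
  shows "partition_on V (move_to P {u} X)"
    and "group_of (move_to P {u} X) u = insert u X"
    and "\<And>Z. Z \<in> move_to P {u} X \<Longrightarrow> Z = insert u X \<or> (\<exists>Z'\<in>P. Z \<subseteq> Z')"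
    and "\<exists>R. group_sizes P = {#card Y, card X#} + R \<and> group_sizes (move_to P {u} X) =
      add_mset (Suc (card X)) ((if card Y = 1 then {#} else {#card Y - 1#}) + R)"
proof -
  define Q where "Q = P - {X, Y}"
  define Y' where "Y' = (if Y = {u} then {} else {Y - {u}})"
  have disj: "A \<inter> B = {}" if "A \<in> P" "B \<in> P" "A \<noteq> B" for A B
    using partition_onD2[OF P] that by (auto simp: disjoint_def)
  have uQ: "u \<notin> Z" if "Z \<in> P" "Z \<noteq> Y" for Z
    using disj[of Z Y] that Y u by blast
  have nonempty: "{} \<notin> P" using partition_onD3[OF P] .
  have PXY: "P - {X} = insert Y Q" using X Y by (auto simp: Q_def)
  have image: "(\<lambda>Z. Z - {u}) ` Q = Q"
    using uQ by (force simp: Q_def)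
  have "{} \<notin> Q" using nonempty by (simp add: Q_def)
  then have "insert (Y - {u}) Q - {{}} = Y' \<union> Q"
    using u by (auto simp: Y'_def)
  moreover have "move_to P {u} X = insert (insert u X) (insert (Y - {u}) Q - {{}})"
    unfolding move_to_def PXY image_insert image by auto
  ultimately have move: "move_to P {u} X = insert (insert u X) (Y' \<union> Q)"
    by simp
  show part: "partition_on V (move_to P {u} X)"
  proof (rule partition_onI)
    show "\<Union> (move_to P {u} X) = V"
      unfolding partition_onD1[OF P] move using X Y u by (auto simp: Y'_def Q_def)
  next
    fix A B assume AB: "A \<in> move_to P {u} X" "B \<in> move_to P {u} X" "A \<noteq> B"
    have XY: "X \<inter> Y = {}" using disj X Y by blast
    have XQ: "X \<inter> Z = {}" "Y \<inter> Z = {}" "u \<notin> Z" if "Z \<in> Q" for Z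
      using that X Y disj uQ unfolding Q_def by blast+
    have QQ: "Z \<inter> Z' = {}" if "Z \<in> Q" "Z' \<in> Q" "Z \<noteq> Z'" for Z Z'
      using that disj[of Z Z'] by (auto simp: Q_def)
    have X': "insert u X \<inter> Z = {}" if "Z \<in> Y' \<union> Q" for Z
      using that XY XQ by (auto simp: Y'_def split: if_splits)
    have Y'Q: "Z \<inter> Z' = {}" if ZZ': "Z \<in> Y' \<union> Q" "Z' \<in> Y' \<union> Q" "Z \<noteq> Z'" for Z Z'
    proof -
      consider "Z \<in> Q" "Z' \<in> Q" | "Z = Y - {u}" "Z' \<in> Q" | "Z \<in> Q" "Z' = Y - {u}"
        using ZZ' by (auto simp: Y'_def split: if_splits)
      then show ?thesis
        using QQ[of Z Z'] XQ(2)[of Z] XQ(2)[of Z'] ZZ'(3) by cases blast+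
    qed
    from AB(1,2) have "A = insert u X \<or> A \<in> Y' \<union> Q" "B = insert u X \<or> B \<in> Y' \<union> Q"
      unfolding move by blast+
    with AB(3) X'[of A] X'[of B] Y'Q[of A B] show "disjnt A B"
      unfolding disjnt_def by blast
  next
    show "{} \<notin> move_to P {u} X" by (simp add: move_to_def)
  qed
  show "group_of (move_to P {u} X) u = insert u X"
    by (rule group_of_eq[OF part]) (simp_all add: move)
  show "Z = insert u X \<or> (\<exists>Z'\<in>P. Z \<subseteq> Z')" if "Z \<in> move_to P {u} X" for Z
    using that Y by (auto simp: move Y'_def Q_def split: if_splits)
  have finP: "finite P" using finite_elements[OF V P] .
  have fin: "finite A" if "A \<in> P" for A
    using that partition_onD1[OF P] V by (auto intro: finite_subset)
  have "group_sizes P = {#card Y, card X#} + group_sizes Q"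
  proof -
    have "P = insert X (insert Y Q)" using PXY X by blast
    moreover have "mset_set (insert X (insert Y Q)) = add_mset X (add_mset Y (mset_set Q))"
      using finP Y(2) by (simp add: Q_def)
    ultimately show ?thesis by (simp add: group_sizes_def)
  qed
  moreover have "group_sizes (move_to P {u} X) =
    add_mset (Suc (card X)) ((if card Y = 1 then {#} else {#card Y - 1#}) + group_sizes Q)"
  proof -
    \<comment> \<open>Sizes are read off a set of groups, so the new groups must be shown distinct
      from the old ones and from each other to count separately.\<close>
    have "insert u X \<notin> Y' \<union> Q"
      using uQ by (auto simp: Y'_def Q_def split: if_splits)
    moreover have "Y' \<inter> Q = {}"
    proof -
      have "Y - {u} \<notin> Q" if "Y \<noteq> {u}"
        using disj[of "Y - {u}" Y] u Y that by (auto simp: Q_def)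
      then show ?thesis by (simp add: Y'_def)
    qed
    moreover have "finite Q" "finite Y'" using finP by (simp_all add: Q_def Y'_def)
    moreover have "card (insert u X) = Suc (card X)"
      using fin[OF X] uQ[OF X Y(2)] by simp
    moreover have "image_mset card (mset_set Y') = (if card Y = 1 then {#} else {#card Y - 1#})"
      using u fin[OF Y(1)] by (auto simp: Y'_def card_1_singleton_iff)
    ultimately show ?thesis
      by (simp add: move group_sizes_def mset_set_Union)
  qed
  ultimately show "\<exists>R. group_sizes P = {#card Y, card X#} + R \<and> group_sizes (move_to P {u} X) =
      add_mset (Suc (card X)) ((if card Y = 1 then {#} else {#card Y - 1#}) + R)"
    by blast
qed

lemma utility_unit:
  assumes "\<And>v. v \<in> group_of P u - {u} \<Longrightarrow> w u v = 1"
  shows "utility w P u = ereal (real (card (group_of P u - {u})))"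
proof -
  have "utility w P u = (\<Sum>v\<in>group_of P u - {u}. ereal 1)"
    unfolding utility_def using assms by (intro sum.cong) (simp_all add: one_ereal_def)
  then show ?thesis by simp
qed

text \<open>In \<open>ereal\<close>, \<open>\<infinity> + -\<infinity> = \<infinity>\<close>, so
  \<open>-\<infinity>\<close> absorbs the sum only because \<open>\<infinity>\<close> is
  excluded.\<close>

lemma utility_MInfty:
  assumes "finite (group_of P u)" "v \<in> group_of P u - {u}" "w u v = -\<infinity>"
    and "\<And>v. v \<in> group_of P u - {u} \<Longrightarrow> w u v \<noteq> \<infinity>"
  shows "utility w P u = -\<infinity>"
proof -
  have "(\<Sum>v\<in>group_of P u - {u} - {v}. w u v) \<noteq> \<infinity>"
    using assms by (auto simp: sum_Pinfty)
  then show ?thesis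
    unfolding utility_def using assms by (simp add: sum.remove[of _ v])
qed

definition unit_groups :: "('a \<Rightarrow> 'a \<Rightarrow> ereal) \<Rightarrow> 'a set set \<Rightarrow> bool" where
  "unit_groups w P \<longleftrightarrow> (\<forall>X\<in>P. \<forall>u\<in>X. \<forall>v\<in>X. u \<noteq> v \<longrightarrow> w u v = 1)"

lemma deviation_step_merge:
  assumes game: "uniform_coloring_game V w" and unit: "unit_groups w P"
    and step: "deviation_step V w 1 P P'"
  shows "unit_groups w P'" "merge_step (group_sizes P) (group_sizes P')"
proof -
  have V: "finite V" and w: "\<And>u v. u \<in> V \<Longrightarrow> v \<in> V \<Longrightarrow> u \<noteq> v \<Longrightarrow> w u v = w v u \<and> w u v \<in> {-\<infinity>, 1}"
    using game by (auto simp: uniform_coloring_game_def coloring_game_def)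
  obtain S X where P: "partition_on V P" and dev: "is_deviation V w 1 P S X"
    and P': "P' = move_to P S X"
    using step by (auto simp: deviation_step_def)
  have "finite S" using dev V by (auto simp: is_deviation_def intro: finite_subset)
  with dev have "card S \<le> 1" "0 < card S"
    by (auto simp: is_deviation_def card_gt_0_iff)
  then have "card S = 1" by linarith
  then obtain u where S: "S = {u}" by (auto simp: card_1_singleton_iff)
  from dev have u: "u \<in> V" "X \<in> insert {} P" and less: "utility w P u < utility w P' u"
    by (auto simp: is_deviation_def S P')
  obtain Y where Y: "Y \<in> P" "u \<in> Y"
    using u(1) partition_onD1[OF P] by blast
  have fin: "finite A" "A \<subseteq> V" if "A \<in> P" for A
    using that partition_onD1[OF P] V by (auto intro: finite_subset)
  have before: "utility w P u = ereal (real (card (Y - {u})))"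
    using unit Y group_of_eq[OF P Y] by (subst utility_unit) (auto simp: unit_groups_def)
  have disj: "A \<inter> B = {}" if "A \<in> P" "B \<in> P" "A \<noteq> B" for A B
    using partition_onD2[OF P] that by (auto simp: disjoint_def)
  have "X \<noteq> Y"
  proof
    assume "X = Y"
    have "Z - {u} = Z" if "Z \<in> P - {Y}" for Z
      using disj[of Z Y] that Y by blast
    then have image: "(\<lambda>Z. Z - {u}) ` (P - {Y}) = P - {Y}" by force
    have "P' = insert (insert u Y) (P - {Y}) - {{}}"
      unfolding P' S move_to_def \<open>X = Y\<close> image by simp
    also have "\<dots> = P"
      using Y partition_onD3[OF P] by (simp add: insert_absorb)
    finally have "P' = P" .
    with less show False by simp
  qed
  \<comment> \<open>A player alone has utility 0, whereas the old utility is a cardinality and hence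
    not negative.\<close>
  have "X \<noteq> {}"
  proof
    assume "X = {}"
    have "group_of P' u = {u}"
      unfolding group_of_def
      by (rule the_equality) (auto simp: P' S move_to_def \<open>X = {}\<close>)
    then have "utility w P' u = 0" by (simp add: utility_def)
    with less before show False by simp
  qed
  with u have X: "X \<in> P" by simp
  note move = move_player[OF P V X Y(1) \<open>X \<noteq> Y\<close> Y(2), folded S, folded P']
  have uX: "u \<notin> X" using disj[OF X Y(1) \<open>X \<noteq> Y\<close>] Y(2) by blast
  have group: "group_of P' u - {u} = X" using move(2) uX by (simp add: S)
  have wX: "w u v = 1 \<and> w v u = 1" if v: "v \<in> X" for v
  proof -
    have inV: "v' \<in> V \<and> v' \<noteq> u" if "v' \<in> X" for v'
      using that fin[OF X] uX by blast
    have finite_weight: "w u v' \<noteq> \<infinity>" if "v' \<in> X" for v'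
      using w[OF u(1), of v'] inV[OF that] by auto
    \<comment> \<open>A single incompatible member of \<open>X\<close> would make the new utility
      \<open>-\<infinity>\<close>, which is no improvement.\<close>
    have "w u v \<noteq> -\<infinity>"
    proof
      assume "w u v = -\<infinity>"
      then have "utility w P' u = -\<infinity>"
        using v group fin(1)[OF X] finite_weight move(2)
        by (intro utility_MInfty[of P' u v]) (auto simp: S)
      with less show False by simp
    qed
    with w[of u v] inV[OF v] u(1) show ?thesis by auto
  qed
  show "unit_groups w P'"
    unfolding unit_groups_def
  proof (intro ballI impI)
    fix Z a b assume Z: "Z \<in> P'" "a \<in> Z" "b \<in> Z" "a \<noteq> b"
    show "w a b = 1"
      using move(3)[OF Z(1)] Z wX X unit unfolding S unit_groups_def by blast
  qed
  have "utility w P' u = ereal (real (card X))"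
    using utility_unit[of P' u w] wX by (simp add: group)
  with less before have "card (Y - {u}) < card X" by simp
  then have "card Y \<le> card X" using Y fin(1)[OF Y(1)] by (simp add: card_Diff_singleton)
  moreover have "1 \<le> card Y" using Y fin(1)[OF Y(1)] by (auto simp: Suc_le_eq card_gt_0_iff)
  ultimately show "merge_step (group_sizes P) (group_sizes P')"
    using move(4) unfolding merge_step_def by blast
qed

lemma group_sizes_singletons: "group_sizes (singletons V) = replicate_mset (card V) 1"
proof -
  have "inj_on (\<lambda>u. {u}) V" by (auto intro: inj_onI)
  then have "group_sizes (singletons V) = image_mset (\<lambda>_. 1) (mset_set V)"
    by (simp add: group_sizes_def singletons_def image_mset_mset_set[symmetric] image_mset.compositionality comp_def)
  then show ?thesis by (simp add: image_mset_const_eq)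
qed

lemma deviation_steps_merge:
  assumes game: "uniform_coloring_game V w"
    and "(deviation_step V w 1 ^^ l) (singletons V) P"
  shows "(merge_step ^^ l) (replicate_mset (card V) 1) (group_sizes P)"
proof -
  have "unit_groups w P \<and> (merge_step ^^ l) (replicate_mset (card V) 1) (group_sizes P)"
    using assms(2)
  proof (induction l arbitrary: P)
    case 0
    then show ?case by (auto simp: unit_groups_def singletons_def group_sizes_singletons[unfolded singletons_def])
  next
    case (Suc l)
    then show ?case using deviation_step_merge[OF game] by (fastforce intro: relpowp_Suc_I)
  qed
  then show ?thesis by blast
qed

section \<open>Realising merging steps in the game with all weights 1\<close>

lemma merge_deviation_step:
  assumes P: "partition_on V P" "finite V" and "merge_step (group_sizes P) N"
  obtains P' where "deviation_step V (\<lambda>_ _. 1) 1 P P'" "partition_on V P'" "group_sizes P' = N"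
proof -
  obtain a b R where ab: "1 \<le> a" "a \<le> b" "group_sizes P = {#a, b#} + R"
    and N: "N = add_mset (Suc b) ((if a = 1 then {#} else {#a - 1#}) + R)"
    using assms(3) unfolding merge_step_def by blast
  have finP: "finite P" using finite_elements[OF P(2,1)] .
  have "a \<in># group_sizes P" by (simp add: ab)
  then obtain Y where Y: "Y \<in> P" "card Y = a"
    using finP by (auto simp: group_sizes_def)
  have "mset_set P = add_mset Y (mset_set (P - {Y}))"
    using finP Y by (metis mset_set.remove)
  with ab(3) Y have "group_sizes (P - {Y}) = add_mset b R"
    by (simp add: group_sizes_def)
  \<comment> \<open>Searching in \<open>P - {Y}\<close> yields a second group even when
    \<open>a = b\<close>.\<close>
  then have "b \<in># group_sizes (P - {Y})" by simp
  then obtain X where X: "X \<in> P" "X \<noteq> Y" "card X = b"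
    using finP by (auto simp: group_sizes_def)
  obtain u where u: "u \<in> Y" using ab(1) Y by fastforce
  note move = move_player[OF P X(1) Y(1) X(2) u]
  define P' where "P' = move_to P {u} X"
  have fin: "finite A" "A \<subseteq> V" if "A \<in> P" for A
    using that partition_onD1[OF P(1)] P(2) by (auto intro: finite_subset)
  have "u \<notin> X" using partition_onD2[OF P(1)] X Y u by (auto simp: disjoint_def)
  then have "utility (\<lambda>_ _. 1) P u < utility (\<lambda>_ _. 1) P' u"
    using move(2) group_of_eq[OF P(1) Y(1) u] u Y X ab(1,2) fin(1)[OF Y(1)]
    by (simp add: utility_unit P'_def)
  then have "is_deviation V (\<lambda>_ _. 1) 1 P {u} X"
    using X(1) u fin(2)[OF Y(1)] by (auto simp: is_deviation_def P'_def)
  then have "deviation_step V (\<lambda>_ _. 1) 1 P P'"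
    unfolding deviation_step_def P'_def using P(1) by blast
  moreover have "group_sizes P' = N"
    using move(4) unfolding P'_def ab(3) N Y(2) X(3) by auto
  ultimately show thesis using that move(1) by (simp add: P'_def)
qed

lemma merge_deviation_steps:
  assumes "finite V" "(merge_step ^^ l) (replicate_mset (card V) 1) M"
  shows "\<exists>P. (deviation_step V (\<lambda>_ _. 1) 1 ^^ l) (singletons V) P"
proof -
  have "\<exists>P. (deviation_step V (\<lambda>_ _. 1) 1 ^^ l) (singletons V) P \<and> partition_on V P \<and> group_sizes P = M"
    using assms(2)
  proof (induction l arbitrary: M)
    case 0
    then show ?case
      using partition_on_singletons[of V]
      by (auto simp: group_sizes_singletons simp flip: singletons_def)
  next
    case (Suc l)
    then obtain K where "(merge_step ^^ l) (replicate_mset (card V) 1) K" "merge_step K M"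
      by auto
    with Suc.IH obtain P where P: "(deviation_step V (\<lambda>_ _. 1) 1 ^^ l) (singletons V) P"
      "partition_on V P" "merge_step (group_sizes P) M" by blast
    from merge_deviation_step[OF P(2) assms(1) P(3)]
    show ?case using relpowp_Suc_I[OF P(1)] by metis
  qed
  then show ?thesis by blast
qed

lemma deviation_lengths_triangular:
  assumes "n = triangular m + r" "r \<le> m"
  shows "finite (deviation_lengths 1 n)" "L 1 n = 2 * ((m + 1) choose 3) + m * r"
proof -
  let ?g = "2 * ((m + 1) choose 3) + m * r"
  have le: "l \<le> ?g" if l: "l \<in> deviation_lengths 1 n" for l
  proof -
    obtain V :: "nat set" and w P where V: "uniform_coloring_game V w" "card V \<le> n"
      and "(deviation_step V w 1 ^^ l) (singletons V) P"
      using l unfolding deviation_lengths_def by blast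
    then have steps: "(merge_step ^^ l) (replicate_mset (card V) 1) (group_sizes P)"
      using deviation_steps_merge by blast
    obtain m' r' where n': "card V = triangular m' + r'" "r' \<le> m'"
      using triangular_decomposition[of "card V"] by blast
    have "l \<le> 2 * ((m' + 1) choose 3) + m' * r'"
      using merge_steps_le[OF n' steps] .
    also have "\<dots> \<le> ?g"
      using V(2) n' assms by (intro weight_mono) auto
    finally show ?thesis .
  qed
  show fin: "finite (deviation_lengths 1 n)"
    using le by (intro finite_subset[OF _ finite_atMost[of ?g]]) auto
  have "?g \<in> deviation_lengths 1 n"
  proof -
    obtain M where "(merge_step ^^ ?g) (replicate_mset (card {..<n}) 1) M"
      using merge_steps_exist[OF assms(2)] assms(1) by auto
    then obtain P where "(deviation_step {..<n} (\<lambda>_ _. 1) 1 ^^ ?g) (singletons {..<n}) P"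
      using merge_deviation_steps[of "{..<n}"] by blast
    moreover have "uniform_coloring_game {..<n} (\<lambda>_ _. 1)"
      by (auto simp: uniform_coloring_game_def coloring_game_def one_ereal_def intro!: range_eqI[of _ _ 1])
    ultimately show ?thesis by (fastforce simp: deviation_lengths_def)
  qed
  with le fin show "L 1 n = ?g"
    unfolding L_def by (intro Max_eqI) auto
qed

section \<open>Asymptotics\<close>

text \<open>From \<open>m\<^sup>2 \<le> s\<^sup>2 \<le> (m + 2)\<^sup>2\<close> follows
  \<open>s - 2 \<le> m \<le> s\<close>. The weight is \<open>(m\<^sup>3 - m) / 3 + m * r\<close>;
  the lower bound discards \<open>m * r\<close>, the upper one uses
  \<open>r \<le> m\<close>.\<close>

lemma weight_bounds:
  fixes m r :: nat and s :: real
  assumes r: "r \<le> m" and s: "s = sqrt (2 * real (triangular m + r))" "3 \<le> s"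
  defines "g \<equiv> real (2 * ((m + 1) choose 3) + m * r)"
  shows "((s - 2) ^ 3 - (s - 2)) / 3 \<le> g" "g \<le> s * (s + 1) * (s + 2) / 3"
proof -
  have choose3: "real (2 * ((m + 1) choose 3)) = (real m ^ 3 - real m) / 3"
  proof (induction m)
    case (Suc m)
    have "2 * (Suc m choose 2) = m * Suc m"
      by (simp add: twice_choose_two)
    then have "real (2 * (Suc m choose 2)) = real m * (real m + 1)"
      by (simp only: of_nat_mult of_nat_Suc) (simp add: algebra_simps)
    with Suc show ?case
      by (simp add: numeral_3_eq_3 numeral_2_eq_2 algebra_simps)
  qed simp
  have s2: "s ^ 2 = real m * (real m + 1) + 2 * real r"
    using s(1) by (simp add: triangular_def real_of_nat_div) (simp add: algebra_simps)
  have "real r \<le> real m" using r by simp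
  then have "s ^ 2 \<le> (real m + 2) ^ 2" "real m ^ 2 \<le> s ^ 2"
    unfolding s2 by (simp_all add: power2_eq_square algebra_simps)
  then have m: "s - 2 \<le> real m" "real m \<le> s"
    using s(2) power2_le_imp_le[of s "real m + 2"] power2_le_imp_le[of "real m" s] by simp_all
  have g: "g = (real m ^ 3 - real m) / 3 + real m * real r"
    using choose3 by (simp add: g_def)
  have "((s - 2) ^ 3 - (s - 2)) = (s - 2) * ((s - 2) ^ 2 - 1)"
    by (simp add: algebra_simps power3_eq_cube power2_eq_square)
  also have "\<dots> \<le> real m * (real m ^ 2 - 1)"
    using s(2) m(1) by (intro mult_mono diff_right_mono power_mono) (auto simp: one_le_power)
  also have "\<dots> = real m ^ 3 - real m"
    by (simp add: algebra_simps power3_eq_cube power2_eq_square)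
  finally show "((s - 2) ^ 3 - (s - 2)) / 3 \<le> g"
    unfolding g by (simp add: add_increasing2)
  have "real m * real r \<le> real m * real m"
    using r by (intro mult_left_mono) auto
  then have "g \<le> real m * (real m + 1) * (real m + 2) / 3"
    unfolding g by (simp add: field_simps power3_eq_cube)
  also have "\<dots> \<le> s * (s + 1) * (s + 2) / 3"
    using m(2) by (intro divide_right_mono mult_mono) auto
  finally show "g \<le> s * (s + 1) * (s + 2) / 3" .
qed

text \<open>Both bounds are asymptotic to \<open>s\<^sup>3 / 3\<close> with
  \<open>s = sqrt (2 * n)\<close>, the order of \<open>m\<close>; this is the source of the 2 under
  the root.\<close>

lemma asymp_equiv_triangular_weight:
  fixes l :: "nat \<Rightarrow> nat"
  assumes "\<And>m r. r \<le> m \<Longrightarrow> l (triangular m + r) = 2 * ((m + 1) choose 3) + m * r"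
  shows "(\<lambda>n. real (l n)) \<sim>[at_top] (\<lambda>n. 2 / 3 * real n * sqrt (2 * real n))"
proof (rule asymp_equiv_sandwich_real)
  let ?s = "\<lambda>n. sqrt (2 * real n)"
  have lim: "filterlim ?s at_top at_top" by real_asymp
  have cube: "?s n ^ 3 / 3 = 2 / 3 * real n * ?s n" for n
    by (simp add: power3_eq_cube)
  have "(\<lambda>s::real. ((s - 2) ^ 3 - (s - 2)) / 3) \<sim>[at_top] (\<lambda>s. s ^ 3 / 3)"
    by real_asymp
  from asymp_equiv_compose'[OF this lim]
  show "(\<lambda>n. ((?s n - 2) ^ 3 - (?s n - 2)) / 3) \<sim>[at_top] (\<lambda>n. 2 / 3 * real n * ?s n)"
    unfolding cube .
  have "(\<lambda>s::real. s * (s + 1) * (s + 2) / 3) \<sim>[at_top] (\<lambda>s. s ^ 3 / 3)"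
    by real_asymp
  from asymp_equiv_compose'[OF this lim]
  show "(\<lambda>n. ?s n * (?s n + 1) * (?s n + 2) / 3) \<sim>[at_top] (\<lambda>n. 2 / 3 * real n * ?s n)"
    unfolding cube .
  show "\<forall>\<^sub>F n in at_top. real (l n) \<in> {((?s n - 2) ^ 3 - (?s n - 2)) / 3..?s n * (?s n + 1) * (?s n + 2) / 3}"
    \<comment> \<open>5 is the least \<open>n\<close> with \<open>2 * n \<ge> 9\<close>, as needed
      for \<open>3 \<le> s\<close>.\<close>
    using eventually_ge_at_top[of 5]
  proof eventually_elim
    case (elim n)
    obtain m r where n: "n = triangular m + r" "r \<le> m"
      using triangular_decomposition[of n] by blast
    have "3 \<le> ?s n" using elim by (intro real_le_rsqrt) simp
    with weight_bounds[OF n(2), of "?s n"] assms[OF n(2)] n show ?case by simp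
  qed
qed

theorem theorem1:
  shows "(\<forall>n::nat.
            (\<exists>!(m, r). n = m * (m + 1) div 2 + r \<and> r \<le> m) \<and>
            (\<forall>m r::nat. n = m * (m + 1) div 2 + r \<and> r \<le> m \<longrightarrow>
               finite (deviation_lengths 1 n) \<and> L 1 n = 2 * ((m + 1) choose 3) + m * r)) \<and>
         (\<lambda>n. real (L 1 n)) \<sim>[at_top] (\<lambda>n. 2 / 3 * real n * sqrt (2 * real n))"
  unfolding triangular_def[symmetric]
proof (intro conjI allI impI)
  show "\<exists>!(m, r). n = triangular m + r \<and> r \<le> m" for n
    by (rule triangular_decomposition)
  show "finite (deviation_lengths 1 n)" "L 1 n = 2 * ((m + 1) choose 3) + m * r"
    if "n = triangular m + r \<and> r \<le> m" for n m r
    using that deviation_lengths_triangular by blast+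
  show "(\<lambda>n. real (L 1 n)) \<sim>[at_top] (\<lambda>n. 2 / 3 * real n * sqrt (2 * real n))"
    using deviation_lengths_triangular(2) by (intro asymp_equiv_triangular_weight) blast
qed

end
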